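(* Let $G$ be a finite abelian group with Sylow $2$-subgroup $P=\langle a_1\rangle\times\cdots\times\langle a_n\rangle$, where $a_i$ has order $2^{m_i}>1$ for $1\le i\le n$, and let $H$ be a proper subgroup of $G$. Then the following hold: (a) for any odd integer $k$ between $1$ and $|H|$, $H$ is a $(0,k)$-regular set of $G$ if and only if $H\cap P$ is a $(0,k)$-regular set of $P$; (b) if $H\cap P$ is cyclic, then for any odd integer $k$ between $1$ and $|H|$, $H$ is a $(0,k)$-regular set of $G$ if and only if either $H\cap P$ is trivial or $H\cap P$ projects onto at least one of $\langle a_1\rangle,\ldots,\langle a_n\rangle$; (c) if $G$ is a cyclic group, then for any odd integer $k$ between $1$ and $|H|$, $H$ is a $(0,k)$-regular set of $G$ if and only if either $|H|$ or $|G:H|$ is odd.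
   Context: All groups are finite. $e$ is the identity of $G$ and $|G:H|$ is the index of $H$ in $G$. For an inverse-closed subset $S$ of $G\setminus\{e\}$ (i.e. $S^{-1}=S$), $\mathrm{Cay}(G,S)$ is the graph with vertex set $G$ and edge set $\{\{x,y\}: x,y\in G,\ yx^{-1}\in S\}$. A $(0,k)$-regular set in a graph $\Gamma$ is a nonempty proper subset $D$ of $V(\Gamma)$ such that every vertex in $D$ has no neighbour in $D$ and every vertex in $V(\Gamma)\setminus D$ has exactly $k$ neighbours in $D$. A subset $D$ of a group $G$ is a $(0,k)$-regular set of $G$ if it is a $(0,k)$-regular set in $\mathrm{Cay}(G,S)$ for some inverse-closed $S\subseteq G\setminus\{e\}$. A subgroup of $P=\langle a_1\rangle\times\cdots\times\langle a_n\rangle$ projects onto $\langle a_i\rangle$ if its image under the coordinate projection $P\to\langle a_i\rangle$ is all of $\langle a_i\rangle$.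
   Formalization: Part (a) fails as worded if P lies in H or k>|H∩P|; its equivalence is proved for P not in H and k≤|H∩P|. For k>|H∩P| (P not in H) the right side becomes "H∩P is a (0,1)-regular set of P"; if P lies in H, H is shown to be a (0,k)-regular set of G. *)

theory Defs
  imports "HOL-Algebra.Algebra"
begin

text \<open>A (simple, undirected) graph is a pair of a vertex set and a set of unordered edges.\<close>

type_synonym 'a ugraph = "'a set \<times> 'a set set"

definition neighbours :: "'a ugraph \<Rightarrow> 'a \<Rightarrow> 'a set" where
  "neighbours \<Gamma> v = {w \<in> fst \<Gamma>. {v, w} \<in> snd \<Gamma>}"

definition zero_regular_set :: "'a ugraph \<Rightarrow> nat \<Rightarrow> 'a set \<Rightarrow> bool" where
  "zero_regular_set \<Gamma> k D \<longleftrightarrow>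
     D \<noteq> {} \<and> D \<subset> fst \<Gamma> \<and>
     (\<forall>v\<in>D. neighbours \<Gamma> v \<inter> D = {}) \<and>
     (\<forall>v\<in>fst \<Gamma> - D. card (neighbours \<Gamma> v \<inter> D) = k)"

definition Cay :: "('a, 'b) monoid_scheme \<Rightarrow> 'a set \<Rightarrow> 'a ugraph" where
  "Cay G S = (carrier G,
     {{x, y} | x y. x \<in> carrier G \<and> y \<in> carrier G \<and> y \<otimes>\<^bsub>G\<^esub> inv\<^bsub>G\<^esub> x \<in> S})"

definition connection_set :: "('a, 'b) monoid_scheme \<Rightarrow> 'a set \<Rightarrow> bool" where
  "connection_set G S \<longleftrightarrow> S \<subseteq> carrier G - {\<one>\<^bsub>G\<^esub>} \<and> set_inv\<^bsub>G\<^esub> S = S"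

definition zero_regular_set_of_group :: "('a, 'b) monoid_scheme \<Rightarrow> nat \<Rightarrow> 'a set \<Rightarrow> bool" where
  "zero_regular_set_of_group G k D \<longleftrightarrow>
     (\<exists>S. connection_set G S \<and> zero_regular_set (Cay G S) k D)"

definition sylow_subgroup :: "('a, 'b) monoid_scheme \<Rightarrow> nat \<Rightarrow> 'a set \<Rightarrow> bool" where
  "sylow_subgroup G p P \<longleftrightarrow> subgroup P G \<and> card P = p ^ multiplicity p (Coset.order G)"

text \<open>For \<open>a :: nat \<Rightarrow> 'a\<close>, \<open>cyclic_product G a n\<close> is the external direct product of the cyclic
  subgroups generated by \<open>a 1, \<dots>, a n\<close>; the subgroup \<open>P\<close> is their internal direct product if
  multiplying components is an isomorphism from the external product onto \<open>P\<close>.\<close>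

definition cyclic_product :: "('a, 'b) monoid_scheme \<Rightarrow> (nat \<Rightarrow> 'a) \<Rightarrow> nat \<Rightarrow> (nat \<Rightarrow> 'a) monoid" where
  "cyclic_product G a n = product_group {1..n} (\<lambda>i. subgroup_generated G {a i})"

definition component_product :: "('a, 'b) monoid_scheme \<Rightarrow> nat \<Rightarrow> (nat \<Rightarrow> 'a) \<Rightarrow> 'a" where
  "component_product G n x = (\<Otimes>\<^bsub>G\<^esub>i\<in>{1..n}. x i)"

definition internal_cyclic_product ::
    "('a, 'b) monoid_scheme \<Rightarrow> 'a set \<Rightarrow> (nat \<Rightarrow> 'a) \<Rightarrow> nat \<Rightarrow> bool" where
  "internal_cyclic_product G P a n \<longleftrightarrow>
     a ` {1..n} \<subseteq> carrier G \<and>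
     component_product G n \<in> iso (cyclic_product G a n) (G\<lparr>carrier := P\<rparr>)"

text \<open>The coordinate projections: decompose an element of the internal direct product and take
  its \<open>i\<close>-th component.\<close>

definition coord_proj ::
    "('a, 'b) monoid_scheme \<Rightarrow> (nat \<Rightarrow> 'a) \<Rightarrow> nat \<Rightarrow> nat \<Rightarrow> 'a \<Rightarrow> 'a" where
  "coord_proj G a n i x =
     the_inv_into (carrier (cyclic_product G a n)) (component_product G n) x i"

definition projects_onto ::
    "('a, 'b) monoid_scheme \<Rightarrow> (nat \<Rightarrow> 'a) \<Rightarrow> nat \<Rightarrow> 'a set \<Rightarrow> nat \<Rightarrow> bool" where
  "projects_onto G a n K i \<longleftrightarrow> coord_proj G a n i ` K = generate G {a i}"

end

theory Submission
  imports Defs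
begin

text \<open>The subgroup \<open>H\<close> is \<open>(0,k)\<close>-regular in \<open>Cay(G,S)\<close> iff \<open>S\<close> misses \<open>H\<close> and meets every other coset
  of \<open>H\<close> in exactly \<open>k\<close> elements. Such an inverse-closed \<open>S\<close> can be chosen freely on pairs of
  distinct mutually inverse cosets; on a self-inverse coset an inverse-closed subset of odd size
  \<open>k\<close> exists iff inversion has a fixed point there. So for odd \<open>k\<close> the question, independently of
  \<open>k\<close>, is whether every involution of \<open>G/H\<close> lifts to an element \<open>y\<close> of \<open>G\<close> with \<open>y\<^sup>2 = 1\<close>. Raising to
  the odd power \<open>|G:P|\<close> moves this question into \<open>P\<close>. If \<open>H \<inter> P = \<langle>c\<rangle>\<close> is nontrivial, involutions
  lift iff \<open>c\<close> is not a square in \<open>P\<close>, i.e. iff some coordinate of \<open>c\<close> is not a square in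
  \<open>\<langle>a\<^sub>i\<rangle>\<close> and hence generates \<open>\<langle>a\<^sub>i\<rangle>\<close>. For cyclic \<open>G\<close>, a lift would be an involution
  outside \<open>H\<close>, but the only involution of \<open>G\<close> lies in \<open>H\<close> when \<open>|H|\<close> is even.\<close>

section \<open>Sets invariant under an involution\<close>

text \<open>Without a fixed point every orbit \<open>{x, f x}\<close> has two elements. Removing one
  orbit leaves a smaller invariant set, still of odd size, to which the induction applies.\<close>

lemma involution_fixed_point:
  assumes "finite A" "odd (card A)" "f ` A \<subseteq> A" "\<And>x. x \<in> A \<Longrightarrow> f (f x) = x"
  shows "\<exists>x\<in>A. f x = x"
  using assms
proof (induction "card A" arbitrary: A rule: less_induct)
  case less
  show ?case
  proof (rule ccontr)
    assume no_fix: "\<not> (\<exists>x\<in>A. f x = x)"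
    from less.prems(2) obtain x where x: "x \<in> A" by fastforce
    let ?B = "A - {x, f x}"
    have fx: "f x \<in> A" "f x \<noteq> x" using x less.prems no_fix by auto
    have "card {x, f x} = 2" using fx by auto
    moreover have "card ?B = card A - card {x, f x}"
      using x fx less.prems(1) by (intro card_Diff_subset) auto
    moreover have "card A \<noteq> 0" "card A \<noteq> 1" using x fx less.prems(1) by (auto simp: card_1_singleton_iff)
    ultimately have card: "card ?B < card A" "odd (card ?B)" using less.prems(2) by auto
    have "f y \<noteq> x \<and> f y \<noteq> f x" if "y \<in> ?B" for y
      using that x less.prems(4) by (metis DiffE insertCI)
    then have "f ` ?B \<subseteq> ?B" using less.prems(3) by auto
    then have "\<exists>y\<in>?B. f y = y" using card less by (intro less.hyps) auto
    with no_fix show False by auto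
  qed
qed

text \<open>Growth by two elements from \<open>{y}\<close>: the complement of an invariant
  \<open>T\<close> is invariant too, so it contains either an orbit of size two or two fixed points,
  and adding these keeps \<open>T\<close> invariant.\<close>

lemma involution_invariant_subset:
  assumes "finite A" "f ` A \<subseteq> A" "\<And>x. x \<in> A \<Longrightarrow> f (f x) = x"
    and "y \<in> A" "f y = y" "odd k" "k \<le> card A"
  shows "\<exists>T\<subseteq>A. f ` T \<subseteq> T \<and> card T = k"
  using assms(6,7)
proof (induction k rule: less_induct)
  case (less k)
  show ?case
  proof (cases "k = 1")
    case True
    with assms(4,5) show ?thesis by (intro exI[of _ "{y}"]) auto
  next
    case False
    with less.prems have k: "k \<ge> 3" by presburger
    then have "k - 2 < k" "odd (k - 2)" "k - 2 \<le> card A" using less.prems by auto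
    then obtain T where T: "T \<subseteq> A" "f ` T \<subseteq> T" "card T = k - 2"
      using less.IH[of "k - 2"] by metis
    have finT: "finite T" using T assms(1) finite_subset by blast
    have stable: "f z \<notin> T" if "z \<in> A - T" for z
      using that T(2) assms(3) by (metis Diff_iff image_subset_iff)
    have big: "card (A - T) \<ge> 2" using T k less.prems finT by (simp add: card_Diff_subset)
    have "\<exists>p q. p \<in> A - T \<and> q \<in> A - T \<and> p \<noteq> q \<and> f ` {p, q} \<subseteq> {p, q}"
    proof (cases "\<exists>p\<in>A - T. f p \<noteq> p")
      case True
      then obtain p where "p \<in> A - T" "f p \<noteq> p" by blast
      then show ?thesis using stable[of p] assms(2,3)
        by (intro exI[of _ p] exI[of _ "f p"]) auto
    next
      case False
      obtain D where "D \<subseteq> A - T" "card D = 2" using big by (meson obtain_subset_with_card_n)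
      then obtain p q where "p \<noteq> q" "p \<in> A - T" "q \<in> A - T" by (auto simp: card_2_iff)
      with False show ?thesis by (intro exI[of _ p] exI[of _ q]) auto
    qed
    then obtain p q where "p \<in> A - T" "q \<in> A - T" "p \<noteq> q" "f ` {p, q} \<subseteq> {p, q}" by blast
    with T k finT show ?thesis by (intro exI[of _ "T \<union> {p, q}"]) auto
  qed
qed

section \<open>Regular subgroups in Cayley graphs\<close>

text \<open>For normal \<open>H\<close>, such an \<open>x\<close> represents an involution of the
  quotient by \<open>H\<close>, and \<open>h \<otimes> x\<close> runs through its coset. Speaking of
  elements instead of the quotient makes the condition easy to transfer to \<open>P\<close>.\<close>

definition lifts_involutions :: "('a, 'b) monoid_scheme \<Rightarrow> 'a set \<Rightarrow> bool" where
  "lifts_involutions G H \<longleftrightarrow>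
     (\<forall>x\<in>carrier G - H. x \<otimes>\<^bsub>G\<^esub> x \<in> H \<longrightarrow>
        (\<exists>h\<in>H. (h \<otimes>\<^bsub>G\<^esub> x) \<otimes>\<^bsub>G\<^esub> (h \<otimes>\<^bsub>G\<^esub> x) = \<one>\<^bsub>G\<^esub>))"

text \<open>Edges are unordered, so \<open>{v, w}\<close> may arise from either quotient of its
  ends; closure of \<open>S\<close> under inverses makes both conditions agree.\<close>

lemma (in group) neighbours_Cay:
  assumes S: "connection_set G S" and v: "v \<in> carrier G"
  shows "neighbours (Cay G S) v = {w \<in> carrier G. w \<otimes> inv v \<in> S}"
proof -
  have "w \<otimes> inv v \<in> S" if "v \<otimes> inv w \<in> S" "w \<in> carrier G" for w
  proof -
    have "inv (v \<otimes> inv w) \<in> S" using S that unfolding connection_set_def SET_INV_def by blast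
    then show ?thesis using that v by (simp add: inv_mult_group)
  qed
  then show ?thesis using v unfolding neighbours_def Cay_def by (auto simp: doubleton_eq_iff)
qed

text \<open>Right translation by \<open>inv v\<close> maps the neighbours of \<open>v\<close> in
  \<open>H\<close> bijectively onto \<open>S \<inter> (H #> inv v)\<close>. For \<open>v\<close> in
  \<open>H\<close> this coset is \<open>H\<close> itself; inversion permutes the complement of
  \<open>H\<close>, so there \<open>inv v\<close> may be renamed \<open>x\<close>.\<close>

lemma (in group) zero_regular_set_Cay_iff:
  assumes S: "connection_set G S" and H: "subgroup H G" and ne: "H \<noteq> carrier G"
  shows "zero_regular_set (Cay G S) k H \<longleftrightarrow>
    S \<inter> H = {} \<and> (\<forall>x\<in>carrier G - H. card (S \<inter> (H #> x)) = k)"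
proof -
  interpret H: subgroup H G by fact
  have SG: "S \<subseteq> carrier G" using S by (auto simp: connection_set_def)
  have bij: "bij_betw (\<lambda>w. w \<otimes> inv v) (neighbours (Cay G S) v \<inter> H) (S \<inter> (H #> inv v))"
    if v: "v \<in> carrier G" for v
  proof (rule bij_betwI[where g = "\<lambda>s. s \<otimes> v"])
    show "(\<lambda>w. w \<otimes> inv v) \<in> neighbours (Cay G S) v \<inter> H \<rightarrow> S \<inter> (H #> inv v)"
      using v S by (auto simp: neighbours_Cay r_coset_def)
    show "(\<lambda>s. s \<otimes> v) \<in> S \<inter> (H #> inv v) \<rightarrow> neighbours (Cay G S) v \<inter> H"
      using v S SG by (auto simp: neighbours_Cay r_coset_def m_assoc)
  qed (use v SG S in \<open>auto simp: neighbours_Cay m_assoc\<close>)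
  have inside: "neighbours (Cay G S) v \<inter> H = {} \<longleftrightarrow> S \<inter> H = {}" if "v \<in> H" for v
    using bij[of v] that H H.mem_carrier by (auto simp: coset_join2 bij_betw_def)
  have outside: "card (neighbours (Cay G S) v \<inter> H) = card (S \<inter> (H #> inv v))"
    if "v \<in> carrier G" for v
    using bij[OF that] by (rule bij_betw_same_card)
  have inv_out: "inv v \<in> carrier G - H" if "v \<in> carrier G - H" for v
    using that by (metis Diff_iff H.m_inv_closed inv_closed inv_inv)
  have "(\<forall>v\<in>carrier G - H. card (S \<inter> (H #> inv v)) = k) \<longleftrightarrow>
        (\<forall>x\<in>carrier G - H. card (S \<inter> (H #> x)) = k)"
    using inv_out by (metis DiffD1 inv_inv)
  then have "(\<forall>v\<in>carrier G - H. card (neighbours (Cay G S) v \<inter> H) = k) \<longleftrightarrow>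
        (\<forall>x\<in>carrier G - H. card (S \<inter> (H #> x)) = k)"
    using outside by simp
  moreover have "(\<forall>v\<in>H. neighbours (Cay G S) v \<inter> H = {}) \<longleftrightarrow> S \<inter> H = {}"
    using inside H.one_closed by blast
  moreover have "fst (Cay G S) = carrier G" by (simp add: Cay_def)
  moreover have "H \<noteq> {}" "H \<subset> carrier G" using H.one_closed H.subset ne by blast+
  ultimately show ?thesis unfolding zero_regular_set_def by simp
qed

lemma (in group) int_pow_double:
  assumes "x \<in> carrier G"
  shows "x [^] j \<otimes> x [^] j = x [^] (2 * j :: int)"
  using int_pow_mult[OF assms, of j j, symmetric] by (simp only: mult_2)

section \<open>Odd regularity and lifts of involutions in abelian groups\<close>

context comm_group
begin

lemma inv_mem_rcoset:
  assumes "subgroup H G" "x \<in> carrier G" "t \<in> H #> x"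
  shows "inv t \<in> H #> inv x"
proof -
  interpret H: subgroup H G by fact
  from assms obtain h where "h \<in> H" "t = h \<otimes> x" by (auto simp: r_coset_def)
  then show ?thesis using assms by (auto simp: r_coset_def inv_mult)
qed

lemma rcoset_inv_eq_iff:
  assumes "subgroup H G" "x \<in> carrier G"
  shows "H #> inv x = H #> x \<longleftrightarrow> x \<otimes> x \<in> H"
proof -
  interpret H: subgroup H G by fact
  have "H #> inv x = H #> x \<longleftrightarrow> x \<in> H #> inv x"
    using assms rcos_self repr_independence by (metis inv_closed)
  also have "\<dots> \<longleftrightarrow> x \<otimes> x \<in> H"
    using assms by (metis H.rcos_module inv_closed inv_inv is_group)
  finally show ?thesis .
qed

text \<open>When \<open>x \<otimes> x\<close> lies in \<open>H\<close>, inversion preserves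
  \<open>S \<inter> (H #> x)\<close>, a set of odd size \<open>k\<close>. A fixed point there is the
  required lift.\<close>

lemma odd_regular_imp_lifts_involutions:
  assumes "finite (carrier G)" "subgroup H G" "H \<noteq> carrier G" "odd k"
    and "zero_regular_set_of_group G k H"
  shows "lifts_involutions G H"
  unfolding lifts_involutions_def
proof (intro ballI impI)
  fix x assume x: "x \<in> carrier G - H" "x \<otimes> x \<in> H"
  obtain S where S: "connection_set G S" "zero_regular_set (Cay G S) k H"
    using assms(5) unfolding zero_regular_set_of_group_def by blast
  let ?A = "S \<inter> (H #> x)"
  have SG: "S \<subseteq> carrier G" using S by (auto simp: connection_set_def)
  have "inv t \<in> ?A" if "t \<in> ?A" for t
    using that S(1) x assms(2) inv_mem_rcoset[of H x t] rcoset_inv_eq_iff[of H x]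
    unfolding connection_set_def SET_INV_def by blast
  moreover have "card ?A = k" using zero_regular_set_Cay_iff S assms x by blast
  moreover have "finite ?A" using SG assms(1) finite_subset by blast
  ultimately have "\<exists>t\<in>?A. inv t = t"
    using assms(4) SG by (intro involution_fixed_point) auto
  then obtain h where "h \<in> H" "inv (h \<otimes> x) = h \<otimes> x" "h \<otimes> x \<in> carrier G"
    using SG by (auto simp: r_coset_def)
  then show "\<exists>h\<in>H. (h \<otimes> x) \<otimes> (h \<otimes> x) = \<one>" by (metis r_inv)
qed

text \<open>The part of the connection set on one coset and its inverse. If the two coincide, the
  lift is a fixed point of inversion, from which an invariant subset of odd size is grown. If not,
  they are disjoint, and any \<open>k\<close> elements of one together with their inverses will
  do.\<close>

lemma symmetric_subset_of_coset_pair: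
  assumes fin: "finite (carrier G)" and H: "subgroup H G" and lift: "lifts_involutions G H"
    and k: "odd k" "k \<le> card H" and x: "x \<in> carrier G - H"
  shows "\<exists>T\<subseteq>(H #> x) \<union> (H #> inv x). m_inv G ` T \<subseteq> T \<and>
           card (T \<inter> (H #> x)) = k \<and> card (T \<inter> (H #> inv x)) = k"
proof -
  interpret H: subgroup H G by fact
  have xG: "x \<in> carrier G" and sub: "H #> x \<subseteq> carrier G" "H #> inv x \<subseteq> carrier G"
    using x by (auto simp: r_coset_subset_G H.subset)
  have finC: "finite (H #> x)" using sub fin finite_subset by blast
  have card: "card (H #> x) = card H"
    using xG H.subset card_rcosets_equal rcosetsI by metis
  show ?thesis
  proof (cases "x \<otimes> x \<in> H")
    case True
    then have eq: "H #> inv x = H #> x" using rcoset_inv_eq_iff H xG by blast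
    obtain h where h: "h \<in> H" "(h \<otimes> x) \<otimes> (h \<otimes> x) = \<one>"
      using lift x True unfolding lifts_involutions_def by blast
    have "inv (h \<otimes> x) = h \<otimes> x" using h xG by (simp add: inv_equality)
    moreover have "h \<otimes> x \<in> H #> x" using h by (auto simp: r_coset_def)
    ultimately have "\<exists>T\<subseteq>H #> x. m_inv G ` T \<subseteq> T \<and> card T = k"
      using inv_mem_rcoset[OF H xG] eq sub k card finC
      by (intro involution_invariant_subset[where y = "h \<otimes> x"]) auto
    then obtain T where "T \<subseteq> H #> x" "m_inv G ` T \<subseteq> T" "card T = k" by blast
    then show ?thesis by (intro exI[of _ T]) (auto simp: eq Int_absorb2)
  next
    case False
    then have "H #> inv x \<noteq> H #> x" using rcoset_inv_eq_iff H xG by blast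
    then have disj: "(H #> x) \<inter> (H #> inv x) = {}"
      using H xG by (metis disjoint_iff inv_closed repr_independence)
    obtain T where T: "T \<subseteq> H #> x" "card T = k"
      using k card by (metis obtain_subset_with_card_n)
    have invT: "m_inv G ` T \<subseteq> H #> inv x" using T inv_mem_rcoset[OF H xG] by blast
    have "inj_on (m_inv G) T" using T sub by (meson inj_on_subset inv_inj order_trans)
    then have "card (m_inv G ` T) = k" using T by (simp add: card_image)
    moreover have "(T \<union> m_inv G ` T) \<inter> (H #> x) = T" using T invT disj by blast
    moreover have "(T \<union> m_inv G ` T) \<inter> (H #> inv x) = m_inv G ` T" using T invT disj by blast
    moreover have "m_inv G ` (T \<union> m_inv G ` T) \<subseteq> T \<union> m_inv G ` T"
      using T sub by auto
    ultimately show ?thesis using T invT by (intro exI[of _ "T \<union> m_inv G ` T"]) auto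
  qed
qed

lemma lifts_involutions_imp_odd_regular:
  assumes fin: "finite (carrier G)" and H: "subgroup H G" and ne: "H \<noteq> carrier G"
    and lift: "lifts_involutions G H" and k: "odd k" "k \<le> card H"
  shows "zero_regular_set_of_group G k H"
proof -
  interpret H: subgroup H G by fact
  let ?U = "\<lambda>x. (H #> x) \<union> (H #> inv x)"
  let ?good = "\<lambda>U T. T \<subseteq> U \<and> m_inv G ` T \<subseteq> T \<and>
      (\<forall>z\<in>carrier G - H. ?U z = U \<longrightarrow> card (T \<inter> (H #> z)) = k)"
  have same: "H #> z = H #> x \<or> H #> z = H #> inv x"
    if "x \<in> carrier G" "z \<in> carrier G" "t \<in> H #> z" "t \<in> ?U x" for x z t
    using that H by (metis UnE inv_closed repr_independence)
  have U_inv: "?U z = ?U x"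
    if "x \<in> carrier G" "z \<in> carrier G" "H #> z = H #> x \<or> H #> z = H #> inv x" for x z
  proof -
    have mem: "z \<in> H #> x \<or> z \<in> H #> inv x" using that rcos_self[OF that(2) H] by auto
    then have "inv z \<in> H #> inv x \<or> inv z \<in> H #> x"
      using inv_mem_rcoset[OF H, of x z] inv_mem_rcoset[OF H, of "inv x" z] that by auto
    with mem that have "(H #> z = H #> x \<and> H #> inv z = H #> inv x) \<or>
        (H #> z = H #> inv x \<and> H #> inv z = H #> x)"
      using inv_mem_rcoset[OF H, of x z] inv_mem_rcoset[OF H, of "inv x" z] H
      by (metis inv_closed inv_inv repr_independence)
    then show ?thesis by blast
  qed
  have "\<exists>T. ?good U T" if "U \<in> ?U ` (carrier G - H)" for U
  proof -
    from that obtain x where x: "x \<in> carrier G - H" "U = ?U x" by blast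
    obtain T where T: "T \<subseteq> ?U x" "m_inv G ` T \<subseteq> T"
        "card (T \<inter> (H #> x)) = k" "card (T \<inter> (H #> inv x)) = k"
      using symmetric_subset_of_coset_pair[OF fin H lift k x(1)] by blast
    have "card (T \<inter> (H #> z)) = k" if "z \<in> carrier G - H" "?U z = U" for z
    proof -
      have "z \<in> ?U x" using that x rcos_self[of z H] H by blast
      then have "H #> z = H #> x \<or> H #> z = H #> inv x"
        using same[of x z z] that x rcos_self[of z H] H by blast
      then show ?thesis using T by auto
    qed
    then show ?thesis using T x by blast
  qed
  \<comment> \<open>The choice is made once for each union \<open>U\<close>, not for each
    \<open>x\<close>: different representatives of the same pair of cosets must receive the same
    subset, or their union could exceed \<open>k\<close> elements in a coset.\<close>
  then have "\<exists>T. \<forall>U\<in>?U ` (carrier G - H). ?good U (T U)"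
    by (intro bchoice ballI)
  then obtain T where T: "\<forall>U\<in>?U ` (carrier G - H). ?good U (T U)" ..
  define S where "S = (\<Union>x\<in>carrier G - H. T (?U x))"
  have T': "T (?U x) \<subseteq> ?U x" "m_inv G ` T (?U x) \<subseteq> T (?U x)" "card (T (?U x) \<inter> (H #> x)) = k"
    if "x \<in> carrier G - H" for x using bspec[OF T imageI[OF that]] that by blast+
  have sub: "?U x \<subseteq> carrier G" if "x \<in> carrier G" for x
    using that by (simp add: r_coset_subset_G H.subset)
  have SG: "S \<subseteq> carrier G" unfolding S_def using T'(1) sub by blast
  \<comment> \<open>Disjointness from \<open>H\<close> also keeps the identity out of
    \<open>S\<close>.\<close>
  have "h \<notin> ?U x" if "x \<in> carrier G - H" "h \<in> H" for h x
  proof -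
    have "h \<in> H #> \<one>" using that by (simp add: coset_mult_one H.subset)
    moreover have "x \<notin> H" "inv x \<notin> H" using that H.m_inv_closed inv_inv by (metis DiffE)+
    ultimately show ?thesis using that same[of x \<one> h] rcos_self[OF _ H]
      by (metis DiffD1 H.subset coset_mult_one inv_closed one_closed)
  qed
  then have SH: "S \<inter> H = {}" unfolding S_def using T'(1) by blast
  have "m_inv G ` S \<subseteq> S" unfolding S_def using T'(2) by blast
  then have "set_inv S = S"
    unfolding SET_INV_def using SG by auto (metis inv_inv subsetD image_subset_iff)
  then have conn: "connection_set G S"
    unfolding connection_set_def using SG SH H.one_closed by blast
  \<comment> \<open>Any \<open>T (?U x)\<close> that meets \<open>H #> z\<close> has
    \<open>?U x = ?U z\<close>, so only one of the chosen sets contributes to this coset.\<close>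
  have "S \<inter> (H #> z) = T (?U z) \<inter> (H #> z)" if z: "z \<in> carrier G - H" for z
  proof -
    have "t \<in> T (?U z)" if "t \<in> S" "t \<in> H #> z" for t
    proof -
      from that(1) have "\<exists>x\<in>carrier G - H. t \<in> T (?U x)"
        unfolding S_def by (simp only: UN_iff)
      then obtain x where x: "x \<in> carrier G - H" "t \<in> T (?U x)" ..
      have "?U z = ?U x" using U_inv same[of x z t] x z that T'(1) by blast
      then show ?thesis using x by simp
    qed
    then show ?thesis using z S_def by blast
  qed
  then have "card (S \<inter> (H #> z)) = k" if "z \<in> carrier G - H" for z using T'(3) that by simp
  then have "zero_regular_set (Cay G S) k H"
    using zero_regular_set_Cay_iff[OF conn H ne] SH by blast
  then show ?thesis using conn zero_regular_set_of_group_def by blast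
qed

lemma odd_regular_iff_lifts_involutions:
  assumes "finite (carrier G)" "subgroup H G" "H \<noteq> carrier G" "odd k" "k \<le> card H"
  shows "zero_regular_set_of_group G k H \<longleftrightarrow> lifts_involutions G H"
  using assms odd_regular_imp_lifts_involutions lifts_involutions_imp_odd_regular by blast

section \<open>Odd powers and the passage to the Sylow 2-subgroup\<close>

lemma subgroup_imp_comm_group:
  assumes "subgroup P G"
  shows "comm_group (G\<lparr>carrier := P\<rparr>)"
  using assms subgroup.mem_carrier[OF assms]
  by (intro group.group_comm_groupI subgroup_imp_group) (auto simp: m_comm)

text \<open>Lagrange's theorem in the factor group by \<open>P\<close>.\<close>

lemma pow_index_mem:
  assumes "subgroup P G" "x \<in> carrier G"
  shows "x [^] card (rcosets P) \<in> P"
proof -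
  interpret P: normal P G using assms(1) by (rule subgroup_imp_normal)
  interpret Q: group "G Mod P" by (rule P.factorgroup_is_group)
  have "P #> x \<in> carrier (G Mod P)" using assms by (simp add: carrier_FactGroup)
  then have "(P #> x) [^]\<^bsub>G Mod P\<^esub> card (rcosets P) = P"
    using Q.pow_order_eq_1[of "P #> x"] by (simp add: order_def FactGroup_def)
  then have "P #> (x [^] card (rcosets P)) = P" using P.FactGroup_pow assms by simp
  then show ?thesis using coset_join1 assms by simp
qed

text \<open>With \<open>r = 2 * l + 1\<close> the power is
  \<open>(x \<otimes> x) [^] l \<otimes> x\<close>. Odd powers thus improve a representative without
  changing its coset.\<close>

lemma odd_pow_coset:
  assumes "subgroup H G" "x \<in> carrier G" "x \<otimes> x \<in> H" "odd (r::nat)"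
  obtains h where "h \<in> H" "x [^] r = h \<otimes> x"
proof -
  interpret H: subgroup H G by fact
  interpret L: group "G\<lparr>carrier := H\<rparr>" using assms(1) by (rule subgroup_imp_group)
  from assms(4) obtain l where r: "r = 2 * l + 1" by (elim oddE)
  have "x [^] r = (x \<otimes> x) [^] l \<otimes> x"
    using assms(2) nat_pow_pow[of x 2 l] by (simp add: r numeral_2_eq_2)
  moreover have "(x \<otimes> x) [^] l \<in> H"
    using L.nat_pow_closed[of "x \<otimes> x" l] assms(3) by (simp flip: nat_pow_consistent)
  ultimately show ?thesis using that by blast
qed

lemma odd_pow_mem_iff:
  assumes "subgroup H G" "x \<in> carrier G" "x \<otimes> x \<in> H" "odd (r::nat)"
  shows "x [^] r \<in> H \<longleftrightarrow> x \<in> H"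
proof -
  interpret H: subgroup H G by fact
  obtain h where h: "h \<in> H" "x [^] r = h \<otimes> x" using odd_pow_coset assms by blast
  have "x = inv h \<otimes> (h \<otimes> x)" using h assms by (simp flip: m_assoc)
  then show ?thesis using h by (metis H.m_closed H.m_inv_closed)
qed

text \<open>Vacuous: a quotient of odd order has no involutions to lift.\<close>

lemma lifts_involutions_if_odd_index:
  assumes "subgroup H G" "odd (card (rcosets H))"
  shows "lifts_involutions G H"
  using assms odd_pow_mem_iff pow_index_mem unfolding lifts_involutions_def by blast

text \<open>The lift is \<open>x [^] card H\<close>, an odd power and hence in the coset of
  \<open>x\<close>; its square is \<open>(x \<otimes> x) [^] card H\<close>, which is trivial by
  Lagrange in \<open>H\<close>.\<close>

lemma lifts_involutions_if_odd_card:
  assumes "subgroup H G" "odd (card H)"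
  shows "lifts_involutions G H"
  unfolding lifts_involutions_def
proof (intro ballI impI)
  fix x assume x: "x \<in> carrier G - H" "x \<otimes> x \<in> H"
  interpret L: group "G\<lparr>carrier := H\<rparr>" using assms(1) by (rule subgroup_imp_group)
  have "(x \<otimes> x) [^] card H = \<one>"
    using L.pow_order_eq_1[of "x \<otimes> x"] x by (simp add: order_def flip: nat_pow_consistent)
  then have "x [^] card H \<otimes> x [^] card H = \<one>" using x pow_mult_distrib by auto
  then show "\<exists>h\<in>H. (h \<otimes> x) \<otimes> (h \<otimes> x) = \<one>" 
    using odd_pow_coset[OF assms(1) _ x(2) assms(2)] x by (metis DiffD1)
qed

text \<open>An even index would contribute one more factor 2 to the group order than its
  multiplicity allows.\<close>

lemma sylow_2_odd_index:
  assumes "finite (carrier G)" "sylow_subgroup G 2 P"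
  shows "odd (card (rcosets P))"
proof
  assume "even (card (rcosets P))"
  moreover have "card (rcosets P) * card P = order G"
    using assms(2) lagrange[of P] unfolding sylow_subgroup_def by blast
  ultimately have "2 * card P dvd order G" by (metis dvd_refl mult_dvd_mono)
  then have "2 ^ Suc (multiplicity 2 (order G)) dvd order G"
    using assms(2) by (simp add: sylow_subgroup_def)
  moreover have "order G \<noteq> 0" using assms(1) order_gt_0_iff_finite by simp
  ultimately show False by (subst (asm) power_dvd_iff_le_multiplicity) auto
qed

text \<open>Let \<open>r\<close> be the index of \<open>P\<close>. For \<open>x\<close> in
  \<open>P\<close>, a lift \<open>h \<otimes> x\<close> has trivial square and its odd power
  \<open>r\<close> in \<open>P\<close>, so it lies in \<open>P\<close>, and \<open>h\<close> does
  too. Conversely \<open>x [^] r = h \<otimes> x\<close> lies in \<open>P\<close> and in the coset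
  of \<open>x\<close>; a lift of it by \<open>g\<close> in \<open>H \<inter> P\<close> is a lift of
  \<open>x\<close> by \<open>g \<otimes> h\<close>.\<close>

lemma lifts_involutions_Int_odd_index:
  assumes H: "subgroup H G" and P: "subgroup P G" and odd: "odd (card (rcosets P))"
  shows "lifts_involutions G H \<longleftrightarrow> lifts_involutions (G\<lparr>carrier := P\<rparr>) (H \<inter> P)"
proof
  interpret H: subgroup H G by fact
  interpret P: subgroup P G by fact
  have pow_mem: "x [^] card (rcosets P) \<in> P" if "x \<in> carrier G" for x
    using pow_index_mem P that by blast
  {
    assume lift: "lifts_involutions G H"
    have "\<exists>h\<in>H \<inter> P. (h \<otimes> x) \<otimes> (h \<otimes> x) = \<one>"
      if x: "x \<in> P" "x \<notin> H" "x \<otimes> x \<in> H" for x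
    proof -
      obtain h where h: "h \<in> H" "(h \<otimes> x) \<otimes> (h \<otimes> x) = \<one>"
        using lift x unfolding lifts_involutions_def by auto
      have "h \<otimes> x \<in> P"
        using odd_pow_mem_iff[OF P _ _ odd, of "h \<otimes> x"] pow_mem h x by auto
      then have "(h \<otimes> x) \<otimes> inv x \<in> P" using x by simp
      then show ?thesis using h x by (auto simp: m_assoc)
    qed
    then show "lifts_involutions (G\<lparr>carrier := P\<rparr>) (H \<inter> P)"
      by (auto simp: lifts_involutions_def)
  }
  assume lift: "lifts_involutions (G\<lparr>carrier := P\<rparr>) (H \<inter> P)"
  have "\<exists>h\<in>H. (h \<otimes> x) \<otimes> (h \<otimes> x) = \<one>"
    if x: "x \<in> carrier G" "x \<notin> H" "x \<otimes> x \<in> H" for x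
  proof -
    let ?y = "x [^] card (rcosets P)"
    have y: "?y \<in> P" "?y \<notin> H" using x pow_mem odd_pow_mem_iff H odd by auto
    obtain h where h: "h \<in> H" "?y = h \<otimes> x" using odd_pow_coset[OF H x(1) x(3) odd] .
    have "?y \<otimes> ?y = (h \<otimes> h) \<otimes> (x \<otimes> x)" unfolding h(2) using h x by (simp add: m_ac)
    then have "?y \<otimes> ?y \<in> H" using h x by simp
    then obtain g where "g \<in> H" "(g \<otimes> ?y) \<otimes> (g \<otimes> ?y) = \<one>"
      using lift y unfolding lifts_involutions_def by auto
    then show ?thesis using h x by (intro bexI[of _ "g \<otimes> h"]) (auto simp: m_assoc)
  qed
  then show "lifts_involutions G H" by (auto simp: lifts_involutions_def)
qed

section \<open>Lifts, squares and generators for cyclic subgroups\<close>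

text \<open>If \<open>c = x \<otimes> x\<close>, a lift \<open>c [^] j \<otimes> x\<close> would
  make the odd power \<open>2 * j + 1\<close> of \<open>c\<close> trivial. Conversely let
  \<open>x \<otimes> x = c [^] j\<close>: for \<open>j = 2 * l + 1\<close> the element
  \<open>c [^] (- l) \<otimes> x\<close> is a square root of \<open>c\<close>, and for
  \<open>j = 2 * l\<close> it is a lift.\<close>

lemma lifts_involutions_generate_iff:
  assumes P: "subgroup P G" and c: "c \<in> P" and ev: "even (ord c)"
  shows "lifts_involutions (G\<lparr>carrier := P\<rparr>) (generate G {c}) \<longleftrightarrow> \<not> (\<exists>x\<in>P. c = x \<otimes> x)"
proof -
  interpret P: subgroup P G by fact
  let ?K = "generate G {c}"
  have cG: "c \<in> carrier G" using c by simp
  have K: "?K = {c [^] j | j::int. True}" using generate_pow[OF cG] by auto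
  have pow: "c [^] j \<in> ?K" for j :: int using K by blast
  have odd_pow: False if "c [^] j = \<one>" "odd j" for j :: int
    using that ev int_pow_eq_id[OF cG, of j] by (meson dvd_trans even_of_nat_iff)
  have dbl: "c [^] j \<otimes> c [^] j = c [^] (2 * j)" for j :: int
    using cG by (rule int_pow_double)
  have sq: "(c [^] j \<otimes> x) \<otimes> (c [^] j \<otimes> x) = c [^] (2 * j) \<otimes> (x \<otimes> x)"
    if "x \<in> carrier G" for x and j :: int
  proof -
    have "(c [^] j \<otimes> x) \<otimes> (c [^] j \<otimes> x) = (c [^] j \<otimes> c [^] j) \<otimes> (x \<otimes> x)"
      using that cG by (simp add: m_ac)
    then show ?thesis by (simp add: dbl)
  qed
  show ?thesis
  proof
    assume lift: "lifts_involutions (G\<lparr>carrier := P\<rparr>) ?K"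
    show "\<not> (\<exists>x\<in>P. c = x \<otimes> x)"
    proof
      assume "\<exists>x\<in>P. c = x \<otimes> x"
      then obtain x where x: "x \<in> P" "c = x \<otimes> x" by blast
      \<comment> \<open>A root \<open>x = c [^] j\<close> would make
        \<open>c [^] (2 * j - 1)\<close> trivial, against the even order of
        \<open>c\<close>.\<close>
      have "x \<notin> ?K"
      proof
        assume "x \<in> ?K"
        then obtain j :: int where "x = c [^] j" using K by blast
        then have "c [^] (2 * j) = c" using x(2) dbl by metis
        then have "c [^] (2 * j) = c [^] (1::int)" using cG by simp
        then have "c [^] (2 * j - 1) = \<one>" using cG int_pow_diff[of c "2 * j" 1] by simp
        then show False using odd_pow[of "2 * j - 1"] by simp
      qed
      moreover have "x \<otimes> x \<in> ?K" using x generate.incl[of c "{c}" G] by simp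
      ultimately obtain j :: int where "(c [^] j \<otimes> x) \<otimes> (c [^] j \<otimes> x) = \<one>"
        using lift x K unfolding lifts_involutions_def by auto
      then have "c [^] (2 * j) \<otimes> c [^] (1::int) = \<one>" using sq x cG by simp
      then have "c [^] (2 * j + 1) = \<one>" using cG int_pow_mult by metis
      then show False using odd_pow[of "2 * j + 1"] by simp
    qed
  next
    assume nsq: "\<not> (\<exists>x\<in>P. c = x \<otimes> x)"
    have "\<exists>h\<in>?K. (h \<otimes> x) \<otimes> (h \<otimes> x) = \<one>" if x: "x \<in> P" "x \<otimes> x \<in> ?K" for x
    proof -
      obtain j :: int where j: "x \<otimes> x = c [^] j" using x K by blast
      have "even j"
      proof (rule ccontr)
        assume "odd j"
        then obtain l where l: "j = 2 * l + 1" by (elim oddE)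
        have "(c [^] (- l) \<otimes> x) \<otimes> (c [^] (- l) \<otimes> x) = c"
          using sq[of x "- l"] x cG by (simp add: j l flip: int_pow_mult)
        moreover have "c [^] (- l) \<otimes> x \<in> P"
          using subgroup_int_pow_closed[OF P c] x by simp
        ultimately show False using nsq by metis
      qed
      then obtain l where l: "j = 2 * l" by (elim evenE)
      have "(c [^] (- l) \<otimes> x) \<otimes> (c [^] (- l) \<otimes> x) = \<one>"
        using sq[of x "- l"] x cG by (simp add: j l flip: int_pow_mult)
      then show ?thesis using pow by blast
    qed
    then show "lifts_involutions (G\<lparr>carrier := P\<rparr>) ?K" by (auto simp: lifts_involutions_def)
  qed
qed

text \<open>Write \<open>d = g [^] j\<close>. In a nontrivial cyclic 2-group the squares are the
  even powers of \<open>g\<close>, and the generators are the odd ones.\<close>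

lemma generates_iff_nonsquare:
  assumes g: "g \<in> carrier G" "ord g = 2 ^ e" "e > 0" and d: "d \<in> generate G {g}"
  shows "generate G {d} = generate G {g} \<longleftrightarrow> \<not> (\<exists>y\<in>generate G {g}. d = y \<otimes> y)"
proof -
  have gen: "generate G {g} = {g [^] j | j::int. True}" using generate_pow[OF g(1)] by auto
  have dG: "d \<in> carrier G" using d generate_in_carrier[of "{g}"] g by auto
  have dbl: "g [^] j \<otimes> g [^] j = g [^] (2 * j)" for j :: int
    using g(1) by (rule int_pow_double)
  have eq_one: "g [^] j = \<one> \<longleftrightarrow> 2 ^ e dvd j" for j :: int
    using int_pow_eq_id[OF g(1), of j] g by simp
  show ?thesis
  proof
    assume eq: "generate G {d} = generate G {g}"
    show "\<not> (\<exists>y\<in>generate G {g}. d = y \<otimes> y)"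
    proof
      assume "\<exists>y\<in>generate G {g}. d = y \<otimes> y"
      then obtain j :: int where j: "d = g [^] (2 * j)" using gen dbl by auto
      have "g \<in> generate G {d}" using eq generate.incl[of g "{g}"] by simp
      then obtain t :: int where "g = d [^] t" using generate_pow[OF dG] by auto
      then have "g [^] (2 * j * t) = g [^] (1::int)" using g j by (simp add: int_pow_pow)
      then have "g [^] (2 * j * t - 1) = \<one>" using g int_pow_diff[of g "2 * j * t" 1] by simp
      then have "2 ^ e dvd 2 * j * t - 1" using eq_one by blast
      then have "even (2 * j * t - 1)" using g(3) by (metis dvd_power dvd_trans)
      then show False by simp
    qed
  next
    assume nsq: "\<not> (\<exists>y\<in>generate G {g}. d = y \<otimes> y)"
    obtain j :: int where j: "d = g [^] j" using d gen by blast
    have "odd j" using nsq gen dbl j by (auto elim!: evenE)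
    then have "coprime j (2 ^ e)" by simp
    \<comment> \<open>Bezout makes \<open>u\<close> an inverse of \<open>j\<close> modulo
      \<open>2 ^ e\<close>, which recovers \<open>g\<close> as \<open>d [^] u\<close>.\<close>
    then obtain u v where "u * j + v * 2 ^ e = 1" using bezout_int[of j "2 ^ e"] by auto
    then have "2 ^ e dvd j * u - 1" by (intro dvdI[of _ _ "- v"]) (simp add: algebra_simps)
    then have "g [^] (j * u) = g [^] (1::int)"
      using eq_one[of "j * u - 1"] g(1) int_pow_diff[of g "j * u" 1]
      by (simp add: inv_equality[symmetric] inv_solve_right')
    then have "g = d [^] u" using j g by (simp add: int_pow_pow)
    then have "g \<in> generate G {d}" using generate_pow[OF dG] by auto
    then show "generate G {d} = generate G {g}"
      using d g dG by (intro equalityI generate_subgroup_incl generate_is_subgroup) auto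
  qed
qed

section \<open>Coordinates in the internal direct product\<close>

lemma group_cyclic_product:
  assumes "a ` {1..n} \<subseteq> carrier G"
  shows "group (cyclic_product G a n)"
  unfolding cyclic_product_def by (intro product_group) simp

lemma carrier_cyclic_product:
  assumes "a ` {1..n} \<subseteq> carrier G"
  shows "carrier (cyclic_product G a n) = (\<Pi>\<^sub>E i\<in>{1..n}. generate G {a i})"
  using assms unfolding cyclic_product_def
  by (auto simp: carrier_subgroup_generated Int_absorb1 intro!: PiE_cong)

lemma mult_cyclic_product:
  "x \<otimes>\<^bsub>cyclic_product G a n\<^esub> y = (\<lambda>i\<in>{1..n}. x i \<otimes> y i)"
  by (simp add: cyclic_product_def)

lemma coord_proj_hom:
  assumes ip: "internal_cyclic_product G P a n" and i: "i \<in> {1..n}"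
  shows "coord_proj G a n i \<in> hom (G\<lparr>carrier := P\<rparr>) G"
    and "\<And>x. x \<in> P \<Longrightarrow> coord_proj G a n i x \<in> generate G {a i}"
proof -
  have a: "a ` {1..n} \<subseteq> carrier G"
    and iso: "component_product G n \<in> iso (cyclic_product G a n) (G\<lparr>carrier := P\<rparr>)"
    using ip by (auto simp: internal_cyclic_product_def)
  let ?C = "cyclic_product G a n" and ?f = "component_product G n"
  interpret C: group ?C using a by (rule group_cyclic_product)
  have f: "inj_on ?f (carrier ?C)" "?f ` carrier ?C = P"
    and f_mult: "\<And>x y. x \<in> carrier ?C \<Longrightarrow> y \<in> carrier ?C \<Longrightarrow> ?f (x \<otimes>\<^bsub>?C\<^esub> y) = ?f x \<otimes> ?f y"
    using iso by (auto simp: iso_def bij_betw_def hom_def)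
  let ?g = "the_inv_into (carrier ?C) ?f"
  have g: "?g x \<in> carrier ?C" "?f (?g x) = x" if "x \<in> P" for x
    using that f the_inv_into_into[OF f(1) _ order_refl] f_the_inv_into_f[OF f(1)] by auto
  \<comment> \<open>Both sides have the same image under the injective map
    \<open>component_product G n\<close>.\<close>
  have g_mult: "?g (x \<otimes> y) = ?g x \<otimes>\<^bsub>?C\<^esub> ?g y" if "x \<in> P" "y \<in> P" for x y
    using that g f_mult f(1) by (intro the_inv_into_f_eq) auto
  show mem: "coord_proj G a n i x \<in> generate G {a i}" if "x \<in> P" for x
    using g(1)[OF that] i unfolding coord_proj_def carrier_cyclic_product[OF a] by auto
  have "generate G {a i} \<subseteq> carrier G" using a i by (intro generate_incl) auto
  then show "coord_proj G a n i \<in> hom (G\<lparr>carrier := P\<rparr>) G"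
    using mem g_mult i by (intro homI) (auto simp: coord_proj_def mult_cyclic_product)
qed

text \<open>Square roots are chosen coordinatewise and multiplied together.\<close>

lemma square_if_coords_square:
  assumes ip: "internal_cyclic_product G P a n" and c: "c \<in> P"
    and sq: "\<And>i. i \<in> {1..n} \<Longrightarrow> \<exists>y\<in>generate G {a i}. coord_proj G a n i c = y \<otimes> y"
  shows "\<exists>x\<in>P. c = x \<otimes> x"
proof -
  have a: "a ` {1..n} \<subseteq> carrier G"
    and iso: "component_product G n \<in> iso (cyclic_product G a n) (G\<lparr>carrier := P\<rparr>)"
    using ip by (auto simp: internal_cyclic_product_def)
  let ?C = "cyclic_product G a n" and ?f = "component_product G n"
  have f: "inj_on ?f (carrier ?C)" "?f ` carrier ?C = P"
    and f_mult: "\<And>x y. x \<in> carrier ?C \<Longrightarrow> y \<in> carrier ?C \<Longrightarrow> ?f (x \<otimes>\<^bsub>?C\<^esub> y) = ?f x \<otimes> ?f y"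
    using iso by (auto simp: iso_def bij_betw_def hom_def)
  let ?z = "the_inv_into (carrier ?C) ?f c"
  have z: "?z \<in> carrier ?C" "?f ?z = c"
    using c f the_inv_into_into[OF f(1) _ order_refl] f_the_inv_into_f[OF f(1)] by auto
  obtain y where y: "\<And>i. i \<in> {1..n} \<Longrightarrow> y i \<in> generate G {a i} \<and> ?z i = y i \<otimes> y i"
    using sq unfolding coord_proj_def by metis
  \<comment> \<open>The restriction makes the family extensional, as membership in the carrier of
    the product group demands.\<close>
  let ?y = "\<lambda>i\<in>{1..n}. y i"
  have yC: "?y \<in> carrier ?C" using y by (auto simp: carrier_cyclic_product[OF a])
  have "?y \<otimes>\<^bsub>?C\<^esub> ?y = ?z"
  proof (rule extensionalityI)
    show "?z \<in> extensional {1..n}" using z carrier_cyclic_product[OF a] by (auto simp: PiE_def)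
  qed (use y in \<open>auto simp: mult_cyclic_product\<close>)
  then have "?f ?y \<otimes> ?f ?y = c" using f_mult[OF yC yC] z by simp
  then show ?thesis using yC f by blast
qed

text \<open>A homomorphism maps the subgroup generated by \<open>c\<close> onto the one generated by
  the image of \<open>c\<close>, so the question is whether the coordinate of \<open>c\<close>
  generates the cyclic 2-group of \<open>a i\<close>.\<close>

lemma projects_onto_generate_iff:
  assumes P: "subgroup P G" and ip: "internal_cyclic_product G P a n" and i: "i \<in> {1..n}"
    and ord: "ord (a i) = 2 ^ e" "e > 0" and c: "c \<in> P"
  shows "projects_onto G a n (generate G {c}) i \<longleftrightarrow>
         \<not> (\<exists>y\<in>generate G {a i}. coord_proj G a n i c = y \<otimes> y)"
proof -
  interpret P: subgroup P G by fact
  let ?p = "coord_proj G a n i"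
  interpret p: group_hom "G\<lparr>carrier := P\<rparr>" G ?p
    using coord_proj_hom(1)[OF ip i] subgroup_imp_group[OF P]
    by (simp add: group_hom_def group_hom_axioms_def)
  have aG: "a i \<in> carrier G" using ip i by (auto simp: internal_cyclic_product_def)
  have "?p ` generate G {c} = generate G {?p c}"
    using p.generate_img[of "{c}"] c P by (simp add: generate_consistent)
  then show ?thesis
    unfolding projects_onto_def
    using generates_iff_nonsquare[OF aG ord coord_proj_hom(2)[OF ip i c]] by simp
qed

lemma nonsquare_iff_projects_onto:
  assumes P: "subgroup P G" and ip: "internal_cyclic_product G P a n"
    and ord: "\<And>i. i \<in> {1..n} \<Longrightarrow> ord (a i) = 2 ^ m i \<and> m i > 0" and c: "c \<in> P"
  shows "\<not> (\<exists>x\<in>P. c = x \<otimes> x) \<longleftrightarrow> (\<exists>i\<in>{1..n}. projects_onto G a n (generate G {c}) i)"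
proof -
  have "\<exists>y\<in>generate G {a i}. coord_proj G a n i c = y \<otimes> y"
    if "x \<in> P" "c = x \<otimes> x" "i \<in> {1..n}" for x i
    using coord_proj_hom[OF ip that(3)] that by (auto simp: hom_def)
  then show ?thesis
    using square_if_coords_square[OF ip c] projects_onto_generate_iff[OF P ip _ _ _ c] ord by blast
qed

end

section \<open>Involutions in cyclic groups\<close>

text \<open>Inversion acts on the odd number of non-identity elements and so fixes one of
  them.\<close>

lemma (in group) even_order_involution:
  assumes "finite (carrier G)" "even (order G)"
  shows "\<exists>x\<in>carrier G. x \<noteq> \<one> \<and> x \<otimes> x = \<one>"
proof -
  have "order G \<noteq> 0" using assms order_gt_0_iff_finite by simp
  then have "odd (card (carrier G - {\<one>}))" using assms by (simp add: order_def)
  then have "\<exists>x\<in>carrier G - {\<one>}. inv x = x"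
    using assms by (intro involution_fixed_point) auto
  then show ?thesis by (metis DiffE insertI1 r_inv)
qed

text \<open>If \<open>g [^] i\<close> is an involution, \<open>2 * i\<close> is an odd multiple of
  \<open>ord g\<close>. Two odd multiples differ by an even one, so the exponents of two involutions
  agree modulo \<open>ord g\<close>.\<close>

lemma (in group) cyclic_group_unique_involution:
  assumes cyc: "cyclic_group G"
    and y: "y \<in> carrier G" "y \<noteq> \<one>" "y \<otimes> y = \<one>" and z: "z \<in> carrier G" "z \<noteq> \<one>" "z \<otimes> z = \<one>"
  shows "y = z"
proof -
  obtain g where g: "g \<in> carrier G" "carrier G = range (\<lambda>n::int. g [^] n)"
    using cyc cyclic_group by blast
  let ?N = "int (ord g)"
  have half: "\<exists>s. 2 * i = ?N * s \<and> odd s"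
    if "g [^] i \<noteq> \<one>" "g [^] i \<otimes> g [^] i = \<one>" for i :: int
  proof -
    have "g [^] (2 * i) = \<one>" using that(2) int_pow_double[OF g(1)] by simp
    then obtain s where s: "2 * i = ?N * s" using int_pow_eq_id[OF g(1)] unfolding dvd_def by blast
    moreover have "odd s"
    proof
      assume "even s"
      then obtain r where "s = 2 * r" by (elim evenE)
      then have "?N dvd i" using s by simp
      then show False using that int_pow_eq_id[OF g(1)] by blast
    qed
    ultimately show ?thesis by blast
  qed
  obtain i j :: int where ij: "y = g [^] i" "z = g [^] j" using y z g by blast
  obtain s t where st: "2 * i = ?N * s" "odd s" "2 * j = ?N * t" "odd t"
    using half[of i] half[of j] y z ij by blast
  then have "even (s - t)" by simp
  then obtain r where r: "s - t = 2 * r" by (elim evenE)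
  have "2 * (i - j) = ?N * (s - t)" using st by (simp add: right_diff_distrib)
  then have "i - j = ?N * r" by (simp add: r)
  then have "?N dvd i - j" by simp
  then have "g [^] (i - j) = \<one>" using int_pow_eq_id[OF g(1)] by blast
  then have "g [^] i \<otimes> inv (g [^] j) = \<one>" using int_pow_diff g(1) by simp
  then show ?thesis using ij g(1) by (metis int_pow_closed inv_closed inv_equality inv_inv)
qed

text \<open>If both numbers are even, \<open>H\<close> contains an involution \<open>z\<close> and
  the quotient has one as well. A lift of the latter is an involution outside \<open>H\<close>,
  hence different from \<open>z\<close>, which contradicts uniqueness.\<close>

lemma (in comm_group) cyclic_group_lifts_involutions_iff:
  assumes cyc: "cyclic_group G" and fin: "finite (carrier G)" and H: "subgroup H G"
  shows "lifts_involutions G H \<longleftrightarrow> odd (card H) \<or> odd (card (rcosets H))"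
proof
  assume lift: "lifts_involutions G H"
  show "odd (card H) \<or> odd (card (rcosets H))"
  proof (rule ccontr)
    assume ev: "\<not> (odd (card H) \<or> odd (card (rcosets H)))"
    interpret H: normal H G using H by (rule subgroup_imp_normal)
    interpret L: group "G\<lparr>carrier := H\<rparr>" using H by (rule subgroup_imp_group)
    interpret Q: group "G Mod H" by (rule H.factorgroup_is_group)
    have "finite H" using fin H.subset finite_subset by blast
    then obtain z where z: "z \<in> H" "z \<noteq> \<one>" "z \<otimes> z = \<one>"
      using L.even_order_involution ev by (auto simp: order_def)
    have "finite (carrier (G Mod H))" using fin by (simp add: carrier_FactGroup)
    then obtain C where "C \<in> carrier (G Mod H)" "C \<noteq> H" "C <#> C = H"
      using Q.even_order_involution ev by (auto simp: order_def FactGroup_def)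
    moreover from \<open>C \<in> carrier (G Mod H)\<close> obtain x where x: "x \<in> carrier G" "C = H #> x"
      by (auto simp: carrier_FactGroup)
    ultimately have "H #> x \<noteq> H" "H #> (x \<otimes> x) = H" using H.rcos_sum[of x x] by simp_all
    then have "x \<notin> H" "x \<otimes> x \<in> H" 
      using H x coset_join1[of H "x \<otimes> x"] coset_join2[of x H] by auto
    then obtain h where h: "h \<in> H" "(h \<otimes> x) \<otimes> (h \<otimes> x) = \<one>"
      using lift x unfolding lifts_involutions_def by blast
    have "h \<otimes> x \<notin> H"
    proof
      assume "h \<otimes> x \<in> H"
      then have "inv h \<otimes> (h \<otimes> x) \<in> H" using h by simp
      then show False using h x \<open>x \<notin> H\<close> by (simp flip: m_assoc)
    qed
    then have "h \<otimes> x \<noteq> z" "h \<otimes> x \<noteq> \<one>" using z by auto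
    then show False using cyclic_group_unique_involution[OF cyc] h x z by auto
  qed
next
  assume "odd (card H) \<or> odd (card (rcosets H))"
  then show "lifts_involutions G H"
    using lifts_involutions_if_odd_card lifts_involutions_if_odd_index H by blast
qed

section \<open>The projection criterion and the three characterizations\<close>

text \<open>A trivial \<open>K\<close> lifts everything, each \<open>x\<close> being its own lift.
  Otherwise \<open>card K\<close> divides a power of 2 and is not 1, so a generator \<open>c\<close>
  has even order and the criterion that \<open>c\<close> be a nonsquare applies.\<close>

lemma (in comm_group) cyclic_lifts_involutions_iff_projects_onto:
  assumes P: "sylow_subgroup G 2 P" and ip: "internal_cyclic_product G P a n"
    and ord: "\<And>i. i \<in> {1..n} \<Longrightarrow> ord (a i) = 2 ^ m i \<and> m i > 0"
    and K: "subgroup K G" "K \<subseteq> P" and cyc: "cyclic_group (G\<lparr>carrier := K\<rparr>)"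
  shows "lifts_involutions (G\<lparr>carrier := P\<rparr>) K \<longleftrightarrow>
         K = {\<one>} \<or> (\<exists>i\<in>{1..n}. projects_onto G a n K i)"
proof (cases "K = {\<one>}")
  case True
  then show ?thesis using P by (auto simp: lifts_involutions_def sylow_subgroup_def dest!: subgroup.mem_carrier)
next
  case False
  have sub: "subgroup P G" and card: "card P = 2 ^ multiplicity 2 (order G)"
    using P by (auto simp: sylow_subgroup_def)
  interpret P: subgroup P G by fact
  interpret L: group "G\<lparr>carrier := K\<rparr>" using K(1) by (rule subgroup_imp_group)
  obtain c where c: "c \<in> K" "carrier (subgroup_generated (G\<lparr>carrier := K\<rparr>) {c}) = K"
    using cyc unfolding cyclic_group_def by force
  then have gen: "generate G {c} = K"
    using K(1) by (simp add: carrier_subgroup_generated generate_consistent)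
  have cP: "c \<in> P" using c K by blast
  have ord_c: "ord c = card K" using generate_pow_card[of c] cP gen by simp
  have "card K dvd order (G\<lparr>carrier := P\<rparr>)"
    using group.lagrange[OF subgroup_imp_group[OF sub] subgroup_incl[OF K(1) sub K(2)]]
    by (metis dvd_triv_right)
  then have "card K dvd 2 ^ multiplicity 2 (order G)"
    by (simp add: order_def[of "G\<lparr>carrier := P\<rparr>"] card)
  then obtain l where l: "card K = 2 ^ l"
    using divides_primepow_nat[OF two_is_prime_nat] by auto
  moreover have "card K \<noteq> 1"
    using False L.one_closed by (auto simp: card_1_singleton_iff)
  ultimately have "even (ord c)" unfolding ord_c by (cases l) auto
  then show ?thesis
    using lifts_involutions_generate_iff[OF sub cP] nonsquare_iff_projects_onto[OF sub ip ord cP]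
      gen False by simp
qed

text \<open>Part (a) distinguishes cases because regularity in \<open>P\<close> can fail for reasons
  of size alone. If \<open>P \<subseteq> H\<close>, then \<open>H \<inter> P\<close> is not a proper
  subset of \<open>P\<close>, while \<open>H\<close> is regular in \<open>G\<close>. If
  \<open>k\<close> exceeds \<open>card (H \<inter> P)\<close>, no vertex can have \<open>k\<close>
  neighbours in \<open>H \<inter> P\<close>, so 1 takes the place of \<open>k\<close>. Otherwise the
  equivalence is the literal one.\<close>

theorem theorem4p8:
  fixes G :: "('a, 'b) monoid_scheme" (structure)
    and P H :: "'a set" and a :: "nat \<Rightarrow> 'a" and m :: "nat \<Rightarrow> nat" and n :: nat
  assumes "comm_group G" and "finite (carrier G)"
    and "sylow_subgroup G 2 P"
    and "internal_cyclic_product G P a n"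
    and "\<And>i. i \<in> {1..n} \<Longrightarrow> group.ord G (a i) = 2 ^ m i \<and> (2::nat) ^ m i > 1"
    and "subgroup H G" and "H \<noteq> carrier G"
  shows
    "(\<forall>k::nat. odd k \<and> 1 \<le> k \<and> k \<le> card H \<longrightarrow>
        (\<not> P \<subseteq> H \<and> k \<le> card (H \<inter> P) \<longrightarrow>
           (zero_regular_set_of_group G k H \<longleftrightarrow>
            zero_regular_set_of_group (G\<lparr>carrier := P\<rparr>) k (H \<inter> P))) \<and>
        (\<not> P \<subseteq> H \<and> card (H \<inter> P) < k \<longrightarrow>
           (zero_regular_set_of_group G k H \<longleftrightarrow>
            zero_regular_set_of_group (G\<lparr>carrier := P\<rparr>) 1 (H \<inter> P))) \<and>
        (P \<subseteq> H \<longrightarrow> zero_regular_set_of_group G k H))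
     \<and>
     (cyclic_group (G\<lparr>carrier := H \<inter> P\<rparr>) \<longrightarrow>
        (\<forall>k::nat. odd k \<and> 1 \<le> k \<and> k \<le> card H \<longrightarrow>
           (zero_regular_set_of_group G k H \<longleftrightarrow>
            H \<inter> P = {\<one>} \<or> (\<exists>i\<in>{1..n}. projects_onto G a n (H \<inter> P) i))))
     \<and>
     (cyclic_group G \<longrightarrow>
        (\<forall>k::nat. odd k \<and> 1 \<le> k \<and> k \<le> card H \<longrightarrow>
           (zero_regular_set_of_group G k H \<longleftrightarrow>
            odd (card H) \<or> odd (card (rcosets H)))))"
proof -
  interpret comm_group G by fact
  have P: "subgroup P G" using assms(3) by (simp add: sylow_subgroup_def)
  interpret P: subgroup P G by fact
  interpret H: subgroup H G by fact
  let ?L = "G\<lparr>carrier := P\<rparr>"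
  interpret L: comm_group ?L using P by (rule subgroup_imp_comm_group)
  have finL: "finite (carrier ?L)" using assms(2) P.subset finite_subset by auto
  have K: "subgroup (H \<inter> P) G" using assms(6) P by (rule subgroups_Inter_pair)
  have KL: "subgroup (H \<inter> P) ?L" using subgroup_incl[OF K P] by simp
  have odd_index: "odd (card (rcosets P))" using sylow_2_odd_index assms(2,3) .
  have ord: "ord (a i) = 2 ^ m i \<and> m i > 0" if "i \<in> {1..n}" for i
    using assms(5)[OF that] by (cases "m i") auto
  have regular_iff: "zero_regular_set_of_group G k H \<longleftrightarrow> lifts_involutions G H"
    if "odd k" "k \<le> card H" for k
    using odd_regular_iff_lifts_involutions assms(2,6,7) that .
  have L_regular_iff: "zero_regular_set_of_group ?L k (H \<inter> P) \<longleftrightarrow> lifts_involutions ?L (H \<inter> P)"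
    if "\<not> P \<subseteq> H" "odd k" "k \<le> card (H \<inter> P)" for k
    using that by (intro L.odd_regular_iff_lifts_involutions finL KL) auto
  have lift_iff: "lifts_involutions G H \<longleftrightarrow> lifts_involutions ?L (H \<inter> P)"
    using lifts_involutions_Int_odd_index[OF assms(6) P odd_index] .
  \<comment> \<open>Here \<open>H \<inter> P\<close> is all of \<open>P\<close>, so nothing in
    \<open>P\<close> is left to lift.\<close>
  have lift_if_subset: "lifts_involutions G H" if "P \<subseteq> H"
    unfolding lift_iff using that by (auto simp: lifts_involutions_def)
  have "finite (H \<inter> P)" "H \<inter> P \<noteq> {}" using finL K subgroup.one_closed by auto
  then have one_le: "1 \<le> card (H \<inter> P)" by (simp add: Suc_le_eq card_gt_0_iff)
  show ?thesis
  proof (intro conjI allI impI)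
    fix k :: nat assume "odd k \<and> 1 \<le> k \<and> k \<le> card H" "P \<subseteq> H"
    then show "zero_regular_set_of_group G k H" using regular_iff lift_if_subset by blast
  next
    fix k :: nat
    assume "odd k \<and> 1 \<le> k \<and> k \<le> card H" "\<not> P \<subseteq> H \<and> k \<le> card (H \<inter> P)"
    then show "zero_regular_set_of_group G k H \<longleftrightarrow> zero_regular_set_of_group ?L k (H \<inter> P)"
      using regular_iff L_regular_iff lift_iff by blast
  next
    fix k :: nat
    assume "odd k \<and> 1 \<le> k \<and> k \<le> card H" "\<not> P \<subseteq> H \<and> card (H \<inter> P) < k"
    \<comment> \<open>Lifting does not mention \<open>k\<close>, so the odd number 1, which never
      exceeds \<open>card (H \<inter> P)\<close>, can be used on the side of
      \<open>P\<close>.\<close>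
    then show "zero_regular_set_of_group G k H \<longleftrightarrow> zero_regular_set_of_group ?L 1 (H \<inter> P)"
      using regular_iff L_regular_iff[of 1] lift_iff one_le by auto
  next
    fix k :: nat
    assume "cyclic_group (G\<lparr>carrier := H \<inter> P\<rparr>)" "odd k \<and> 1 \<le> k \<and> k \<le> card H"
    then show "zero_regular_set_of_group G k H \<longleftrightarrow>
        H \<inter> P = {\<one>} \<or> (\<exists>i\<in>{1..n}. projects_onto G a n (H \<inter> P) i)"
      using regular_iff lift_iff
        cyclic_lifts_involutions_iff_projects_onto[OF assms(3,4) ord K] by simp
  next
    fix k :: nat assume "cyclic_group G" "odd k \<and> 1 \<le> k \<and> k \<le> card H"
    then show "zero_regular_set_of_group G k H \<longleftrightarrow> odd (card H) \<or> odd (card (rcosets H))"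
      using regular_iff cyclic_group_lifts_involutions_iff[OF _ assms(2,6)] by blast
  qed
qed

end
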